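(* Let $\mathbb{F}$ be a field and let $\mathcal{A}$ be a unital, not necessarily associative $\mathbb{F}$-algebra of finite dimension $\dim \mathcal{A} = n > 2$. Then $l(\mathcal{A}) \le 2^{n-2}$.
   Context: Let $\mathcal{A}$ be a unital finite-dimensional, not necessarily associative algebra over a field $\mathbb{F}$, and let $\mathcal{S}$ be a finite subset of $\mathcal{A}$. For $i\ge 1$, a word in $\mathcal{S}$ of length $i$ is a product of $i$ elements of $\mathcal{S}$ (repetitions allowed) with some arrangement of brackets; different arrangements of brackets give different words of the same length. The element $1$ is regarded as a word of length $0$. For $i \ge 0$, $S_i$ is the set of all words in $\mathcal{S}$ of length at most $i$, and $\mathcal{L}_i(\mathcal{S})$ is the $\mathbb{F}$-linear span of (the values in $\mathcal{A}$ of) $S_i$; in particular $\mathcal{L}_0(\mathcal{S}) = \mathbb{F}\cdot 1$. Put $\mathcal{L}(\mathcal{S}) = \bigcup_{i\ge 0}\mathcal{L}_i(\mathcal{S})$. The set $\mathcal{S}$ is a generating set of $\mathcal{A}$ if $\mathcal{L}(\mathcal{S}) = \mathcal{A}$. The length of a generating set $\mathcal{S}$ is $l(\mathcal{S}) = \min\{k \in \mathbb{Z}_{\ge 0} : \mathcal{L}_k(\mathcal{S}) = \mathcal{A}\}$, and the length of the algebra is $l(\mathcal{A}) = \max\{ l(\mathcal{S}) : \mathcal{S} \text{ finite}, \ \mathcal{L}(\mathcal{S}) = \mathcal{A}\}$. *)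

theory Defs
  imports Complex_Main
begin

text \<open>The type of vectors is the whole algebra; bilinearity of the product is
  linearity in each argument.\<close>

locale unital_nonassoc_algebra = vector_space scale
  for scale :: "'k::field \<Rightarrow> 'a::ab_group_add \<Rightarrow> 'a" +
  fixes mult :: "'a \<Rightarrow> 'a \<Rightarrow> 'a"
    and unit :: 'a
  assumes linear_mult_left: "Vector_Spaces.linear scale scale (\<lambda>x. mult x y)"
    and linear_mult_right: "Vector_Spaces.linear scale scale (\<lambda>y. mult x y)"
    and unit_left: "mult unit x = x"
    and unit_right: "mult x unit = x"

locale findim_unital_nonassoc_algebra = unital_nonassoc_algebra scale mult unit
  for scale :: "'k::field \<Rightarrow> 'a::ab_group_add \<Rightarrow> 'a" and mult unit +
  assumes finite_dimensional: "\<exists>B. finite B \<and> span B = UNIV"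

text \<open>Bracketed words of length at least 1. The empty word is not a value of this type,
  so that it does not occur as a factor of longer words.\<close>

datatype (letters: 'a) bracketed = Letter 'a | Prod "'a bracketed" "'a bracketed"

primrec word_length :: "'a bracketed \<Rightarrow> nat" where
  "word_length (Letter a) = 1"
| "word_length (Prod u v) = word_length u + word_length v"

context unital_nonassoc_algebra
begin

primrec word_value :: "'a bracketed \<Rightarrow> 'a" where
  "word_value (Letter a) = a"
| "word_value (Prod u v) = mult (word_value u) (word_value v)"

definition word_values :: "'a set \<Rightarrow> nat \<Rightarrow> 'a set" where
  "word_values S i =
     (if i = 0 then {unit} else word_value ` {w. letters w \<subseteq> S \<and> word_length w = i})"

definition word_span :: "'a set \<Rightarrow> nat \<Rightarrow> 'a set" where
  "word_span S i = span (\<Union>j\<le>i. word_values S j)"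

definition generating :: "'a set \<Rightarrow> bool" where
  "generating S \<longleftrightarrow> (\<Union>i. word_span S i) = UNIV"

definition set_length :: "'a set \<Rightarrow> nat" where
  "set_length S = (LEAST k. word_span S k = UNIV)"

definition algebra_length :: nat where
  "algebra_length = Max {set_length S |S. finite S \<and> generating S}"

end

end

theory Submission
  imports Defs
begin

text \<open>
  Write \<open>L\<^sub>k\<close> for \<^term>\<open>word_span S k\<close> and call \<open>k \<ge> 1\<close> a jump if \<open>L\<^sub>k\<close> is strictly larger than
  \<open>L\<^sub>k\<^sub>-\<^sub>1\<close>. If \<open>k \<ge> 2\<close> is a jump, then some word of length \<open>k\<close> has a value outside \<open>L\<^sub>k\<^sub>-\<^sub>1\<close>. Cut it at
  its outermost product into factors of lengths \<open>s + t = k\<close>. Since \<open>L\<^sub>i L\<^sub>j \<subseteq> L\<^sub>i\<^sub>+\<^sub>j\<close>, neither factor can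
  be expressed by shorter words, so \<open>s\<close> and \<open>t\<close> are jumps as well, and the longer of the two is at
  least \<open>k/2\<close> (\<open>jump_halving\<close>). Hence each jump beyond \<open>1\<close> is at most twice an
  earlier one.

  Descending in this way from any jump ends at the jump \<open>1\<close>. Every jump raises the dimension, and
  \<open>L\<^sub>0\<close> is a line, spanned by the unit. So \<open>dim L\<^sub>1 \<ge> 2\<close>, and each doubling of \<open>k\<close> costs one
  further dimension; this gives \<open>k \<le> 2 ^ (dim L\<^sub>k - 2)\<close> at every jump (\<open>jump_le_power_dim\<close>). The
  length of a generating set, unless it is \<open>0\<close>, is the last jump, at which the dimension is \<open>n\<close>.
\<close>

lemma word_length_pos: "0 < word_length w"
  by (induction w) auto

context unital_nonassoc_algebra
begin

lemma word_values_mult: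
  assumes "x \<in> word_values S i" "y \<in> word_values S j"
  shows "mult x y \<in> word_values S (i + j)"
proof (cases "i = 0 \<or> j = 0")
  case True
  then show ?thesis
    using assms by (auto simp: word_values_def unit_left unit_right)
next
  case False
  then obtain u v where "letters u \<subseteq> S" "word_length u = i" "x = word_value u"
    "letters v \<subseteq> S" "word_length v = j" "y = word_value v"
    using assms by (auto simp: word_values_def)
  then have "mult x y \<in> word_value ` {w. letters w \<subseteq> S \<and> word_length w = i + j}"
    by (intro image_eqI[of _ _ "Prod u v"]) auto
  then show ?thesis
    using False by (simp add: word_values_def)
qed

lemma word_span_mono: "i \<le> j \<Longrightarrow> word_span S i \<subseteq> word_span S j"
  unfolding word_span_def by (intro span_mono UN_mono) auto

lemma word_values_subset_word_span: "word_values S i \<subseteq> word_span S i"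
  unfolding word_span_def by (auto intro: span_base)

lemma word_span_mult:
  assumes x: "x \<in> word_span S i" and y: "y \<in> word_span S j"
  shows "mult x y \<in> word_span S (i + j)"
proof -
  interpret left: Vector_Spaces.linear scale scale "\<lambda>x. mult x b" for b
    by (rule linear_mult_left)
  interpret right: Vector_Spaces.linear scale scale "\<lambda>y. mult a y" for a
    by (rule linear_mult_right)
  have sub: "subspace (word_span S (i + j))"
    by (simp add: word_span_def)
  have gens: "mult a b \<in> word_span S (i + j)"
    if a: "a \<in> (\<Union>p\<le>i. word_values S p)" and b: "b \<in> (\<Union>q\<le>j. word_values S q)" for a b
  proof -
    from a b obtain p q where "p \<le> i" "q \<le> j" "mult a b \<in> word_values S (p + q)"
      by (auto intro: word_values_mult)
    moreover from \<open>p \<le> i\<close> \<open>q \<le> j\<close> have "word_span S (p + q) \<subseteq> word_span S (i + j)"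
      by (intro word_span_mono) simp
    ultimately show ?thesis
      using word_values_subset_word_span by blast
  qed
  have half: "mult a y \<in> word_span S (i + j)" if a: "a \<in> (\<Union>p\<le>i. word_values S p)" for a
    using y unfolding word_span_def[of S j]
  proof (rule span_induct)
    show "subspace {z. mult a z \<in> word_span S (i + j)}"
      using right.subspace_vimage[OF sub] by (simp add: vimage_def)
  qed (use gens a in auto)
  show ?thesis
    using x unfolding word_span_def[of S i]
  proof (rule span_induct)
    show "subspace {z. mult z y \<in> word_span S (i + j)}"
      using left.subspace_vimage[OF sub] by (simp add: vimage_def)
  qed (use half in auto)
qed

definition jump :: "'a set \<Rightarrow> nat \<Rightarrow> bool" where
  "jump S k \<longleftrightarrow> 0 < k \<and> word_span S (k - 1) \<noteq> word_span S k"

lemma jump_iff_fresh_value: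
  "jump S k \<longleftrightarrow> 0 < k \<and> (\<exists>x\<in>word_values S k. x \<notin> word_span S (k - 1))"
proof (cases k)
  case (Suc m)
  have "word_span S (Suc m) \<subseteq> word_span S m" if "word_values S (Suc m) \<subseteq> word_span S m"
    unfolding word_span_def[of S "Suc m"]
  proof (rule span_minimal)
    show "(\<Union>j\<le>Suc m. word_values S j) \<subseteq> word_span S m"
      using that by (auto simp: atMost_Suc word_span_def intro: span_base)
  qed (simp add: word_span_def)
  then show ?thesis
    using Suc word_span_mono[of m "Suc m" S] word_values_subset_word_span[of S "Suc m"]
    by (auto simp: jump_def)
qed (simp add: jump_def)

text \<open>
  If one factor of a word were a combination of shorter words, then by \<open>word_span_mult\<close> so would be
  the whole word. A word with a fresh value therefore has two fresh factors, and the longer one has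
  at least half of the length.
\<close>

lemma jump_halving:
  assumes "jump S k" "2 \<le> k"
  obtains s where "jump S s" "s < k" "k \<le> 2 * s"
proof -
  obtain w where w: "letters w \<subseteq> S" "word_length w = k" "word_value w \<notin> word_span S (k - 1)"
    using assms by (auto simp: jump_iff_fresh_value word_values_def)
  then obtain u v where uv: "w = Prod u v"
    using assms(2) by (cases w) auto
  have len: "word_length u + word_length v = k"
    using w uv by simp
  note pos = word_length_pos[of u] word_length_pos[of v]
  have in_span: "word_value z \<in> word_span S (word_length z)" if "letters z \<subseteq> S" for z
    using that word_length_pos[of z] word_values_subset_word_span[of S "word_length z"]
    by (auto simp: word_values_def)
  have "word_value u \<notin> word_span S (word_length u - 1)"
    using word_span_mult[of "word_value u" S "word_length u - 1" "word_value v" "word_length v"]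
      in_span[of v] w uv len pos by auto
  then have u: "jump S (word_length u)"
    using in_span[of u] w(1) uv pos by (auto simp: jump_def)
  have "word_value v \<notin> word_span S (word_length v - 1)"
    using word_span_mult[of "word_value u" S "word_length u" "word_value v" "word_length v - 1"]
      in_span[of u] w uv len pos by auto
  then have v: "jump S (word_length v)"
    using in_span[of v] w(1) uv pos by (auto simp: jump_def)
  show thesis
  proof (cases "word_length v \<le> word_length u")
    case True
    show thesis by (rule that[OF u]) (use len pos True in auto)
  next
    case False
    show thesis by (rule that[OF v]) (use len pos False in auto)
  qed
qed

end

context findim_unital_nonassoc_algebra
begin

text \<open>
  Thinning the finite spanning set to a basis gives access to the theory of dimension in
  \<^locale>\<open>finite_dimensional_vector_space\<close>, where the basis is a parameter.
\<close>

lemma dim_strict_mono: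
  assumes "span A \<subset> span B"
  shows "dim A < dim B"
proof -
  obtain C where "finite C" "span C = UNIV"
    using finite_dimensional by blast
  moreover obtain D where "D \<subseteq> C" "independent D" "span D = span C"
    using maximal_independent_subset[of C] span_mono[of _ C] span_minimal[of C]
    by (metis span_eq subset_trans span_superset)
  ultimately interpret finite_dimensional_vector_space scale D
    by unfold_locales (auto intro: finite_subset)
  show ?thesis
    using assms by (rule dim_psubset)
qed

lemma dim_word_span_before_jump:
  assumes "jump S k" "j < k"
  shows "dim (word_span S j) < dim (word_span S k)"
proof (rule dim_strict_mono)
  have "word_span S j \<subseteq> word_span S (k - 1)" "word_span S (k - 1) \<subset> word_span S k"
    using assms word_span_mono[of j "k - 1" S] word_span_mono[of "k - 1" k S]
    by (auto simp: jump_def)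
  then show "span (word_span S j) \<subset> span (word_span S k)"
    by (simp add: word_span_def span_span)
qed

text \<open>The unit vanishes only in the zero algebra, where there are no jumps.\<close>

lemma dim_word_span_0_pos:
  assumes "jump S k"
  shows "0 < dim (word_span S 0)"
proof -
  have "unit \<noteq> 0"
  proof
    assume "unit = 0"
    interpret left: Vector_Spaces.linear scale scale "\<lambda>x. mult x b" for b
      by (rule linear_mult_left)
    have "mult 0 x = 0" for x
      by (rule left.zero)
    then have "x = y" for x y :: 'a
      using \<open>unit = 0\<close> unit_left by metis
    then show False
      using assms by (auto simp: jump_iff_fresh_value word_span_def span_zero) (metis span_zero)
  qed
  then show ?thesis
    by (simp add: word_span_def word_values_def dim_span dim_eq_card_independent)
qed

text \<open>
  The induction descends from a jump to the earlier one of at least half its size, where the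
  dimension is smaller. The bound \<open>2 \<le> dim\<close> is carried along because the truncated exponent
  must really decrease at each descent.
\<close>

lemma jump_le_power_dim:
  assumes "jump S k"
  shows "2 \<le> dim (word_span S k) \<and> k \<le> 2 ^ (dim (word_span S k) - 2)"
  using assms
proof (induction k rule: less_induct)
  case (less k)
  show ?case
  proof (cases "2 \<le> k")
    case True
    obtain s where s: "jump S s" "s < k" "k \<le> 2 * s"
      using jump_halving[OF less.prems True] .
    have IH: "2 \<le> dim (word_span S s)" "s \<le> 2 ^ (dim (word_span S s) - 2)"
      using less.IH[OF s(2) s(1)] by auto
    have lt: "dim (word_span S s) < dim (word_span S k)"
      using dim_word_span_before_jump less.prems s(2) by blast
    have "k \<le> 2 ^ Suc (dim (word_span S s) - 2)"
      using s(3) IH(2) by simp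
    also have "\<dots> \<le> 2 ^ (dim (word_span S k) - 2)"
      using lt IH(1) by (intro power_increasing) auto
    finally show ?thesis
      using lt IH(1) by simp
  next
    case False
    then have "k = 1"
      using less.prems by (auto simp: jump_def)
    then show ?thesis
      using dim_word_span_before_jump[OF less.prems, of 0] dim_word_span_0_pos[OF less.prems]
      by simp
  qed
qed

lemma generating_iff: "generating S \<longleftrightarrow> (\<exists>k. word_span S k = UNIV)"
proof
  assume gen: "generating S"
  obtain B where B: "finite B" "span B = UNIV"
    using finite_dimensional by blast
  have "\<forall>b. \<exists>i. b \<in> word_span S i"
    using gen by (auto simp: generating_def)
  then obtain f where f: "\<And>b. b \<in> word_span S (f b)"
    by metis
  have "b \<in> word_span S (Max (f ` B))" if "b \<in> B" for b
    using f[of b] word_span_mono[of "f b" "Max (f ` B)" S] B that by auto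
  then have "span B \<subseteq> word_span S (Max (f ` B))"
    by (intro span_minimal) (auto simp: word_span_def)
  then show "\<exists>k. word_span S k = UNIV"
    using B by auto
qed (auto simp: generating_def)

lemma set_length_le:
  assumes "generating S"
  shows "set_length S \<le> 2 ^ (dim UNIV - 2)"
proof (cases "set_length S = 0")
  case False
  have full: "word_span S (set_length S) = UNIV"
    using assms unfolding set_length_def generating_iff by (rule LeastI_ex)
  moreover have "word_span S (set_length S - 1) \<noteq> UNIV"
    using False not_less_Least[of "set_length S - 1" "\<lambda>k. word_span S k = UNIV"]
    by (auto simp: set_length_def)
  ultimately have "jump S (set_length S)"
    using False by (auto simp: jump_def)
  then show ?thesis
    using jump_le_power_dim full by metis
qed simp

text \<open>
  The maximum in \<^const>\<open>algebra_length\<close> is taken over a finite set because of the bound itself, and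
  over a nonempty one because a finite spanning set generates.
\<close>

lemma algebra_length_le: "algebra_length \<le> 2 ^ (dim UNIV - 2)"
proof -
  let ?M = "{set_length S |S. finite S \<and> generating S}"
  have bound: "m \<le> 2 ^ (dim UNIV - 2)" if "m \<in> ?M" for m
    using that set_length_le by auto
  then have "finite ?M"
    by (meson finite_nat_set_iff_bounded_le)
  moreover have "?M \<noteq> {}"
  proof -
    obtain B where B: "finite B" "span B = UNIV"
      using finite_dimensional by blast
    have "b \<in> word_values B 1" if "b \<in> B" for b
      using that by (auto simp: word_values_def intro!: image_eqI[of _ _ "Letter b"])
    then have "span B \<subseteq> word_span B 1"
      unfolding word_span_def by (intro span_mono) blast
    then have "generating B"
      using B generating_iff by blast
    then show ?thesis
      using B by blast
  qed
  ultimately show ?thesis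
    unfolding algebra_length_def using bound by (subst Max_le_iff) auto
qed

end

theorem proposition4p2:
  fixes scale :: "'k::field \<Rightarrow> 'a::ab_group_add \<Rightarrow> 'a"
    and mult :: "'a \<Rightarrow> 'a \<Rightarrow> 'a"
    and unit :: 'a
    and n :: nat
  assumes "findim_unital_nonassoc_algebra scale mult unit"
    and "vector_space.dim scale (UNIV :: 'a set) = n"
    and "n > 2"
  shows "unital_nonassoc_algebra.algebra_length scale mult unit \<le> 2 ^ (n - 2)"
  using findim_unital_nonassoc_algebra.algebra_length_le[OF assms(1)] assms(2) by simp

end
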